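(* Let $T,A$ be two operators on a Hilbert space $\mathcal{H}$ and $\rho > 0$. Suppose that $T$ and $A$ are members of the class $\zeta_\rho$ and possess unitary $\rho$-dilations on a common Hilbert space $\mathcal{K}\supseteq \mathcal{H}$. Suppose $T\perp_B A$. Then for all unitary $\rho$-dilations $U_T$ of $T$ and $U_A$ of $A$ on $\mathcal{K}$, $U_T\perp_B^\varepsilon U_A$ for every $\varepsilon\in [\kappa,1)$, where $$\kappa=\eta_0\sqrt{1-\frac{\|T\|^2}{\rho^2}},\qquad \eta_0=\min\{\eta_1,\eta_2\},$$ $$\eta_1=\sup\left\{\zeta\geq 0:\ \lim_{n\to\infty}\sqrt{1-\tfrac{\|Ax_n\|^2}{\rho^2}} = \zeta \text{ for some sequence } (x_n)\subseteq\mathcal{H} \text{ with } \|x_n\|=1,\ \lim_{n\to\infty}\|Tx_n\| = \|T\|\right\},$$ $$\eta_2=\sup\left\{\zeta\geq 0:\ \lim_{n\to\infty}\sqrt{1-\tfrac{\|A^*x_n\|^2}{\rho^2}} = \zeta \text{ for some sequence } (x_n)\subseteq\mathcal{H} \text{ with } \|x_n\|=1,\ \lim_{n\to\infty}\|T^*x_n\| = \|T^*\|\right\}.$$ Moreover, $U_T\perp_B U_A$ if $\|T\|=\rho$. In addition, if $\|A\|=\rho$ and if every norming sequence of $T$ is also a norming sequence of $A$ (or every norming sequence of $T^*$ is also a norming sequence of $A^*$), then $U_T\perp_B U_A$.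
   Context: All Hilbert spaces are complex and separable, and all operators are bounded and linear. For operators $X,Y$ on the same Hilbert space, $X\perp_B Y$ (Birkhoff-James orthogonality) means $\|X+\lambda Y\|\ge\|X\|$ for every $\lambda\in\mathbb{C}$; for $\varepsilon\in[0,1)$, $X\perp_B^\varepsilon Y$ means $\|X+\lambda Y\|^2\ge\|X\|^2-2\varepsilon\|X\|\|\lambda Y\|$ for every $\lambda\in\mathbb{C}$ (operator norm). A norming sequence of an operator $X$ is a sequence of unit vectors $(x_n)$ with $\lim_{n\to\infty}\|Xx_n\|=\|X\|$. For $\rho>0$, a unitary operator $U$ on a Hilbert space $\mathcal{K}\supseteq\mathcal{H}$ is a unitary $\rho$-dilation of $T\in\mathcal{B}(\mathcal{H})$ if $T^n=\rho P_{\mathcal{H}}U^n|_{\mathcal{H}}$ for every integer $n\ge 1$, where $P_{\mathcal{H}}:\mathcal{K}\to\mathcal{H}$ is the orthogonal projection. The class $\zeta_\rho$ consists of all operators that possess a unitary $\rho$-dilation; every $T\in\zeta_\rho$ satisfies $\|T\|\le\rho$. *)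

theory Defs
  imports "HOL-Analysis.Analysis"
begin

class complex_inner = real_normed_vector +
  fixes scaleC :: "complex \<Rightarrow> 'a \<Rightarrow> 'a" (infixr "*\<^sub>C" 75)
    and cinner :: "'a \<Rightarrow> 'a \<Rightarrow> complex"
  assumes scaleC_add_right: "c *\<^sub>C (x + y) = c *\<^sub>C x + c *\<^sub>C y"
    and scaleC_add_left: "(c + d) *\<^sub>C x = c *\<^sub>C x + d *\<^sub>C x"
    and scaleC_scaleC: "c *\<^sub>C d *\<^sub>C x = (c * d) *\<^sub>C x"
    and scaleR_scaleC: "r *\<^sub>R x = complex_of_real r *\<^sub>C x"
    and cinner_commute: "cinner x y = cnj (cinner y x)"
    and cinner_add_left: "cinner (x + y) z = cinner x z + cinner y z"
    and cinner_scaleC_left: "cinner (c *\<^sub>C x) y = c * cinner x y"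
    and cinner_self: "cinner x x = complex_of_real ((norm x)\<^sup>2)"

text \<open>For metric spaces, second countability is the same as separability.\<close>

class separable_chilbert = complex_inner + banach + second_countable_topology

instantiation complex :: separable_chilbert
begin

definition scaleC_complex :: "complex \<Rightarrow> complex \<Rightarrow> complex"
  where "scaleC_complex c x = c * x"

definition cinner_complex :: "complex \<Rightarrow> complex \<Rightarrow> complex"
  where "cinner_complex x y = x * cnj y"

instance
proof
  fix x :: complex
  show "cinner x x = complex_of_real ((norm x)\<^sup>2)"
    unfolding cinner_complex_def by (rule complex_norm_square [symmetric])
qed (simp_all add: scaleC_complex_def cinner_complex_def algebra_simps scaleR_conv_of_real)

end

definition bounded_clinear :: "('a::complex_inner \<Rightarrow> 'b::complex_inner) \<Rightarrow> bool"
  where "bounded_clinear T \<longleftrightarrow> bounded_linear T \<and> (\<forall>c x. T (c *\<^sub>C x) = c *\<^sub>C T x)"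

definition cadjoint :: "('a::complex_inner \<Rightarrow> 'b::complex_inner) \<Rightarrow> 'b \<Rightarrow> 'a"
  where "cadjoint T = (SOME S. \<forall>x y. cinner (T x) y = cinner x (S y))"

definition unitary :: "('a::complex_inner \<Rightarrow> 'a) \<Rightarrow> bool"
  where "unitary U \<longleftrightarrow> bounded_clinear U \<and> cadjoint U \<circ> U = id \<and> U \<circ> cadjoint U = id"

definition orth_proj :: "'a::complex_inner set \<Rightarrow> 'a \<Rightarrow> 'a"
  where "orth_proj M y = (THE p. p \<in> M \<and> (\<forall>m\<in>M. cinner (y - p) m = 0))"

definition birkhoff_james :: "('a::complex_inner \<Rightarrow> 'a) \<Rightarrow> ('a \<Rightarrow> 'a) \<Rightarrow> bool"
  where "birkhoff_james X Y \<longleftrightarrow>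
    (\<forall>z::complex. onorm (\<lambda>x. X x + z *\<^sub>C Y x) \<ge> onorm X)"

definition approx_birkhoff_james ::
  "real \<Rightarrow> ('a::complex_inner \<Rightarrow> 'a) \<Rightarrow> ('a \<Rightarrow> 'a) \<Rightarrow> bool"
  where "approx_birkhoff_james \<epsilon> X Y \<longleftrightarrow>
    (\<forall>z::complex. (onorm (\<lambda>x. X x + z *\<^sub>C Y x))\<^sup>2
        \<ge> (onorm X)\<^sup>2 - 2 * \<epsilon> * onorm X * onorm (\<lambda>x. z *\<^sub>C Y x))"

definition norming_sequence ::
  "('a::complex_inner \<Rightarrow> 'b::complex_inner) \<Rightarrow> (nat \<Rightarrow> 'a) \<Rightarrow> bool"
  where "norming_sequence X x \<longleftrightarrow>
    (\<forall>n. norm (x n) = 1) \<and> (\<lambda>n. norm (X (x n))) \<longlonglongrightarrow> onorm X"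

text \<open>
  An inclusion of Hilbert spaces H into K is rendered as a linear isometry J from the type
  of H to the type of K; then H is identified with the range of J.
\<close>

definition isometric_embedding :: "('h::complex_inner \<Rightarrow> 'k::complex_inner) \<Rightarrow> bool"
  where "isometric_embedding J \<longleftrightarrow> bounded_clinear J \<and> (\<forall>x. norm (J x) = norm x)"

definition unitary_dilation ::
  "('h::complex_inner \<Rightarrow> 'k::complex_inner) \<Rightarrow> real \<Rightarrow> ('h \<Rightarrow> 'h) \<Rightarrow> ('k \<Rightarrow> 'k) \<Rightarrow> bool"
  where "unitary_dilation J \<rho> T U \<longleftrightarrow> unitary U \<and>
    (\<forall>n\<ge>1. \<forall>x. J ((T ^^ n) x) = \<rho> *\<^sub>R orth_proj (range J) ((U ^^ n) (J x)))"

text \<open>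
  The bounded operators with a unitary dilation on the Hilbert space of the given type.
  The dilation space of a member of the class is arbitrary, but types cannot be quantified
  inside a formula; in a hypothesis, a type variable of its own in the first argument
  expresses that some dilation space exists.
\<close>

definition zeta_class ::
  "'k::separable_chilbert itself \<Rightarrow> real \<Rightarrow> ('h::separable_chilbert \<Rightarrow> 'h) set"
  where "zeta_class _ \<rho> = {T. bounded_clinear T \<and>
    (\<exists>(J :: 'h \<Rightarrow> 'k) U. isometric_embedding J \<and> unitary_dilation J \<rho> T U)}"

definition eta :: "real \<Rightarrow> ('h::complex_inner \<Rightarrow> 'h) \<Rightarrow> ('h \<Rightarrow> 'h) \<Rightarrow> real"
  where "eta \<rho> T A = Sup {\<zeta>. \<zeta> \<ge> 0 \<and>
    (\<exists>x. norming_sequence T x \<and> (\<lambda>n. sqrt (1 - (norm (A (x n)))\<^sup>2 / \<rho>\<^sup>2)) \<longlonglongrightarrow> \<zeta>)}"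

definition kappa :: "real \<Rightarrow> ('h::complex_inner \<Rightarrow> 'h) \<Rightarrow> ('h \<Rightarrow> 'h) \<Rightarrow> real"
  where "kappa \<rho> T A =
    min (eta \<rho> T A) (eta \<rho> (cadjoint T) (cadjoint A)) * sqrt (1 - (onorm T)\<^sup>2 / \<rho>\<^sup>2)"

end

theory Submission imports Defs begin

text \<open>
  Split a vector of \<open>K\<close> into its component in \<open>H\<close> and its component orthogonal to \<open>H\<close>. For a unit
  vector \<open>x\<close> of \<open>H\<close>, the component of \<open>U\<^sub>T x\<close> in \<open>H\<close> is \<open>T x / \<rho>\<close>, so the orthogonal one has
  length \<open>\<surd>(1 - \<parallel>T x\<parallel>\<^sup>2/\<rho>\<^sup>2)\<close>, and likewise for \<open>A\<close>. Hence \<open>\<langle>U\<^sub>T x, U\<^sub>A x\<rangle>\<close> differs from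
  \<open>\<langle>T x, A x\<rangle>/\<rho>\<^sup>2\<close> by at most the product of these two lengths
  (\<open>cinner_compression_error\<close>). Since \<open>U\<^sub>T\<close> and \<open>U\<^sub>A\<close> are isometries,
  \<open>\<parallel>U\<^sub>T + zU\<^sub>A\<parallel>\<^sup>2 \<ge> \<parallel>U\<^sub>T x + zU\<^sub>A x\<parallel>\<^sup>2 = 1 + \<bar>z\<bar>\<^sup>2 + 2 Re (cnj z \<langle>U\<^sub>T x, U\<^sub>A x\<rangle>)\<close>.

  It remains to choose \<open>x\<close> along a norming sequence of \<open>T\<close> for which \<open>Re (cnj z \<langle>T x, A x\<rangle>)\<close> is
  asymptotically nonnegative. Because \<open>z\<close> is fixed before the sequence, this one-sided condition in one
  direction is enough, and it follows directly from \<open>\<parallel>T + (z/n)A\<parallel> \<ge> \<parallel>T\<parallel>\<close>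
  (\<open>birkhoff_james_norming_sequence\<close>); a single sequence with \<open>\<langle>T x\<^sub>n, A x\<^sub>n\<rangle> \<longlonglongrightarrow> 0\<close>, which would
  require the convexity of a numerical range, is avoided. Passing to a subsequence along which the
  defect of \<open>A\<close> converges, necessarily to a limit at most \<open>\<eta>\<^sub>1\<close>, gives the bound with \<open>\<eta>\<^sub>1\<close>
  (\<open>approx_birkhoff_james_compression\<close>).

  Birkhoff-James orthogonality is invariant under adjoints, and the adjoints of \<open>U\<^sub>T\<close>, \<open>U\<^sub>A\<close> compress to
  those of \<open>T\<close>, \<open>A\<close>, so the same bound holds with \<open>\<eta>\<^sub>2\<close>. In the remaining two assertions
  \<open>\<kappa> \<le> 0\<close>: the root factor vanishes if \<open>\<parallel>T\<parallel> = \<rho>\<close>, and the condition on norming sequences forces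
  \<open>\<eta>\<^sub>1\<close> or \<open>\<eta>\<^sub>2\<close> to vanish. Approximate orthogonality with \<open>\<epsilon> = 0\<close> is orthogonality.

  The adjoint is a choice and the projection a definite description; that they have their
  defining properties rests on the Riesz representation theorem (\<open>riesz_representation\<close>).
\<close>

section \<open>Elementary inner product geometry\<close>

lemma scaleC_one [simp]: "1 *\<^sub>C x = (x :: 'a::complex_inner)"
  using scaleR_scaleC [of 1 x] by simp

lemma cinner_add_right: "cinner x (y + z) = cinner x y + cinner (x :: 'a::complex_inner) z"
  by (metis cinner_commute cinner_add_left complex_cnj_add)

lemma cinner_scaleC_right: "cinner x (c *\<^sub>C y) = cnj c * cinner (x :: 'a::complex_inner) y"
  by (metis cinner_commute cinner_scaleC_left complex_cnj_mult)

lemma scaleC_minus_one: "(- 1) *\<^sub>C x = - (x :: 'a::complex_inner)"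
  using scaleR_scaleC [of "- 1" x] by simp

lemma cinner_minus_left: "cinner (- x) y = - cinner (x :: 'a::complex_inner) y"
  by (metis cinner_scaleC_left mult_minus1 scaleC_minus_one)

lemma cinner_diff_left: "cinner (x - z) y = cinner x y - cinner (z :: 'a::complex_inner) y"
  by (metis cinner_add_left cinner_minus_left diff_conv_add_uminus)

lemma cinner_diff_right: "cinner y (x - z) = cinner y x - cinner y (z :: 'a::complex_inner)"
  by (metis cinner_commute cinner_diff_left complex_cnj_diff)

lemma cinner_zero_left [simp]: "cinner 0 (y :: 'a::complex_inner) = 0"
  using cinner_diff_left [of y y y] by simp

lemma cinner_scaleR_left: "cinner (r *\<^sub>R x) y = of_real r * cinner (x :: 'a::complex_inner) y"
  by (simp add: scaleR_scaleC cinner_scaleC_left)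

lemma cinner_scaleR_right: "cinner x (r *\<^sub>R y) = of_real r * cinner (x :: 'a::complex_inner) y"
  by (simp add: scaleR_scaleC cinner_scaleC_right)

lemma norm_add_scaleC_square:
  fixes x y :: "'a::complex_inner"
  shows "(norm (x + c *\<^sub>C y))\<^sup>2 = (norm x)\<^sup>2 + (cmod c)\<^sup>2 * (norm y)\<^sup>2 + 2 * Re (cnj c * cinner x y)"
proof -
  have "complex_of_real ((norm (x + c *\<^sub>C y))\<^sup>2) = cinner (x + c *\<^sub>C y) (x + c *\<^sub>C y)"
    by (rule cinner_self [symmetric])
  also have "\<dots> = cinner x x + (c * cnj c) * cinner y y + (cnj c * cinner x y + cnj (cnj c * cinner x y))"
    using cinner_commute [of y x]
    by (simp add: cinner_add_left cinner_add_right cinner_scaleC_left cinner_scaleC_right algebra_simps)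
  also have "\<dots> = complex_of_real ((norm x)\<^sup>2 + (cmod c)\<^sup>2 * (norm y)\<^sup>2 + 2 * Re (cnj c * cinner x y))"
    unfolding complex_add_cnj complex_norm_square [symmetric] cinner_self by simp
  finally show ?thesis
    unfolding of_real_eq_iff .
qed

lemma norm_scaleC: "norm (c *\<^sub>C x) = cmod c * norm (x :: 'a::complex_inner)"
proof -
  have "(norm (c *\<^sub>C x))\<^sup>2 = (cmod c * norm x)\<^sup>2"
    using norm_add_scaleC_square [of "0::'a" c x] by (simp add: power_mult_distrib)
  then show ?thesis
    by (simp add: power2_eq_iff_nonneg)
qed

lemma scaleC_zero_right [simp]: "c *\<^sub>C (0 :: 'a::complex_inner) = 0"
  using norm_scaleC [of c "0 :: 'a"] by simp

lemma norm_cinner_le: "cmod (cinner x y) \<le> norm x * norm (y :: 'a::complex_inner)"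
proof (cases "y = 0")
  case True
  then show ?thesis
    by (metis cinner_commute cinner_zero_left complex_cnj_zero norm_zero mult_zero_right order_refl)
next
  case False
  define w where "w = cinner x y"
  define c where "c = - (w / of_real ((norm y)\<^sup>2))"
  have ny: "norm y > 0" using False by simp
  \<comment> \<open>this multiple of \<open>y\<close> is minus the component of \<open>x\<close> along \<open>y\<close>\<close>
  have "0 \<le> (norm (x + c *\<^sub>C y))\<^sup>2" by simp
  also have "\<dots> = (norm x)\<^sup>2 + (cmod c)\<^sup>2 * (norm y)\<^sup>2 + 2 * Re (cnj c * w)"
    unfolding w_def by (rule norm_add_scaleC_square)
  also have "Re (cnj c * w) = - ((cmod w)\<^sup>2 / (norm y)\<^sup>2)"
  proof -
    have "cnj c * w = - (w * cnj w / of_real ((norm y)\<^sup>2))"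
      by (simp add: c_def mult.commute)
    also have "\<dots> = of_real (- ((cmod w)\<^sup>2 / (norm y)\<^sup>2))"
      unfolding complex_norm_square [symmetric] by simp
    finally show ?thesis by (metis Re_complex_of_real)
  qed
  also have "(cmod c)\<^sup>2 * (norm y)\<^sup>2 = (cmod w)\<^sup>2 / (norm y)\<^sup>2"
  proof -
    have "cmod c = cmod w / (norm y)\<^sup>2"
      by (simp add: c_def norm_divide norm_power)
    then show ?thesis using ny by (simp add: power_divide power2_eq_square)
  qed
  finally have "(cmod w)\<^sup>2 / (norm y)\<^sup>2 \<le> (norm x)\<^sup>2" by simp
  then have "(cmod w)\<^sup>2 \<le> (norm x * norm y)\<^sup>2"
    using ny by (simp add: field_simps)
  then show ?thesis
    unfolding w_def by (rule power2_le_imp_le) simp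
qed

lemma cinner_ext:
  fixes u v :: "'a::complex_inner"
  assumes "\<And>x. cinner x u = cinner x v"
  shows "u = v"
proof -
  have "cinner (u - v) (u - v) = 0"
    using assms by (simp add: cinner_diff_right)
  then show ?thesis
    by (simp add: cinner_self)
qed

section \<open>Riesz representation and adjoints\<close>

lemma bounded_clinearD:
  assumes "bounded_clinear T"
  shows "bounded_linear T" "T (c *\<^sub>C x) = c *\<^sub>C T x" "T (x + y) = T x + T y"
    "T (r *\<^sub>R x) = r *\<^sub>R T x"
  using assms by (auto simp: bounded_clinear_def linear_simps)

lemma bounded_linear_scaleC: "bounded_linear (\<lambda>x :: 'a::complex_inner. c *\<^sub>C x)"
proof (rule bounded_linear_intro [where K = "cmod c"])
  show "c *\<^sub>C (r *\<^sub>R x) = r *\<^sub>R c *\<^sub>C x" for r and x :: 'a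
    by (simp add: scaleR_scaleC scaleC_scaleC mult.commute)
qed (simp_all add: scaleC_add_right norm_scaleC mult.commute)

lemma bounded_clinear_add_scaleC:
  assumes "bounded_clinear T" "bounded_clinear A"
  shows "bounded_clinear (\<lambda>x. T x + c *\<^sub>C A x)"
proof -
  have "bounded_linear (\<lambda>x. c *\<^sub>C A x)"
    using bounded_linear_compose [OF bounded_linear_scaleC bounded_clinearD(1) [OF assms(2)]] .
  then show ?thesis
    using assms
    by (simp add: bounded_clinear_def bounded_linear_add scaleC_add_right scaleC_scaleC mult.commute)
qed

text \<open>The stationarity condition at a minimum of a quadratic: for a small step against \<open>b\<close> the linear
  term dominates.\<close>

lemma quadratic_nonneg_imp_linear_zero:
  fixes a b :: real
  assumes "\<And>t. 0 \<le> 2 * t * b + t\<^sup>2 * a"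
  shows "b = 0"
proof (rule ccontr)
  assume "b \<noteq> 0"
  define s where "s = 1 / (1 + \<bar>a\<bar>)"
  have s: "s > 0" "s * a \<le> 1" "s * \<bar>a\<bar> \<le> 1"
    by (auto simp: s_def field_simps)
  have "0 \<le> 2 * (- (s * b)) * b + (- (s * b))\<^sup>2 * a" by (rule assms)
  also have "\<dots> = s * b\<^sup>2 * (s * a - 2)" by (simp add: power2_eq_square algebra_simps)
  also have "\<dots> < 0" using s \<open>b \<noteq> 0\<close> by (intro mult_pos_neg) auto
  finally show False by simp
qed

text \<open>The representing vector minimises \<open>\<parallel>x\<parallel>\<^sup>2 - 2 Re (f x)\<close>: this functional is bounded below,
  the parallelogram law makes every minimising sequence Cauchy, and stationarity at the
  minimiser is the representation formula.\<close>

lemma riesz_representation: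
  fixes f :: "'a::{complex_inner, banach} \<Rightarrow> complex"
  assumes f: "bounded_clinear f"
  shows "\<exists>u. \<forall>x. f x = cinner x u"
proof -
  note bl = bounded_clinearD(1) [OF f]
  define \<phi> where "\<phi> x = (norm x)\<^sup>2 - 2 * Re (f x)" for x
  define K where "K = onorm f"
  have K: "cmod (f x) \<le> K * norm x" for x
    unfolding K_def by (rule onorm [OF bl])
  have lower: "- K\<^sup>2 \<le> \<phi> x" for x
  proof -
    have "Re (f x) \<le> K * norm x"
      using K [of x] complex_Re_le_cmod [of "f x"] by linarith
    moreover have "0 \<le> (norm x - K)\<^sup>2" by simp
    ultimately show ?thesis
      by (simp add: \<phi>_def power2_eq_square algebra_simps)
  qed
  define m where "m = Inf (range \<phi>)"
  have bdd: "bdd_below (range \<phi>)"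
    by (rule bdd_belowI [where m = "- K\<^sup>2"]) (use lower in auto)
  have m: "m \<le> \<phi> x" for x
    unfolding m_def using bdd by (intro cInf_lower) auto
  have "\<exists>x. \<phi> x < m + inverse (real (Suc n))" for n
  proof -
    have "Inf (range \<phi>) < m + inverse (real (Suc n))" unfolding m_def by simp
    then show ?thesis using cInf_less_iff [OF _ bdd] by auto
  qed
  then obtain X where X: "\<And>n. \<phi> (X n) < m + inverse (real (Suc n))" by metis
  have par: "(norm (x - y))\<^sup>2 \<le> 2 * (\<phi> x - m) + 2 * (\<phi> y - m)" for x y
  proof -
    have "(norm (x + y))\<^sup>2 = (norm x)\<^sup>2 + (norm y)\<^sup>2 + 2 * Re (cinner x y)"
      using norm_add_scaleC_square [of x 1 y] by simp
    moreover have "(norm (x - y))\<^sup>2 = (norm x)\<^sup>2 + (norm y)\<^sup>2 - 2 * Re (cinner x y)"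
      using norm_add_scaleC_square [of x "- 1" y] by (simp add: scaleC_minus_one)
    moreover have "(norm ((1/2) *\<^sub>R (x + y)))\<^sup>2 = (norm (x + y))\<^sup>2 / 4"
      by (simp only: norm_scaleR power_mult_distrib) (simp add: power_divide)
    moreover have "Re (f ((1/2) *\<^sub>R (x + y))) = (Re (f x) + Re (f y)) / 2"
      by (simp only: bounded_clinearD(3,4) [OF f]) simp
    ultimately show ?thesis
      using m [of "(1/2) *\<^sub>R (x + y)"] by (simp add: \<phi>_def)
  qed
  have "Cauchy X"
  proof (rule metric_CauchyI)
    fix e :: real assume "e > 0"
    then obtain N where N: "inverse (real (Suc N)) < e\<^sup>2 / 4"
      using reals_Archimedean [of "e\<^sup>2 / 4"] by auto
    have small: "\<phi> (X n) - m < e\<^sup>2 / 4" if "n \<ge> N" for n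
    proof -
      have "inverse (real (Suc n)) \<le> inverse (real (Suc N))" using that by (simp add: le_imp_inverse_le)
      then show ?thesis using X [of n] N by linarith
    qed
    have "dist (X i) (X j) < e" if "i \<ge> N" "j \<ge> N" for i j
    proof -
      have "(norm (X i - X j))\<^sup>2 \<le> 2 * (\<phi> (X i) - m) + 2 * (\<phi> (X j) - m)" by (rule par)
      also have "\<dots> < 2 * (e\<^sup>2 / 4) + 2 * (e\<^sup>2 / 4)"
        by (intro add_strict_mono mult_strict_left_mono small that) simp_all
      finally have "(norm (X i - X j))\<^sup>2 < e\<^sup>2" by simp
      then have "norm (X i - X j) < e"
        by (rule power2_less_imp_less) (use \<open>e > 0\<close> in simp)
      then show ?thesis by (simp only: dist_norm)
    qed
    then show "\<exists>M. \<forall>i\<ge>M. \<forall>j\<ge>M. dist (X i) (X j) < e" by blast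
  qed
  then obtain u where u: "X \<longlonglongrightarrow> u"
    using convergent_eq_Cauchy by blast
  have "(\<lambda>n. \<phi> (X n)) \<longlonglongrightarrow> \<phi> u"
    unfolding \<phi>_def by (intro tendsto_intros u bounded_linear.tendsto [OF bl])
  moreover have "(\<lambda>n. m + inverse (real (Suc n))) \<longlonglongrightarrow> m + 0"
    by (intro tendsto_intros LIMSEQ_inverse_real_of_nat)
  ultimately have "\<phi> u \<le> m + 0"
    by (rule LIMSEQ_le) (use X less_imp_le in blast)
  then have min: "\<phi> u \<le> \<phi> x" for x using m [of x] by linarith
  have re: "Re (f x) = Re (cinner x u)" for x
  proof -
    have "0 \<le> 2 * t * (Re (cinner u x) - Re (f x)) + t\<^sup>2 * (norm x)\<^sup>2" for t
      using min [of "u + t *\<^sub>R x"] norm_add_scaleC_square [of u "of_real t" x]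
      by (simp add: \<phi>_def scaleR_scaleC [symmetric] bounded_clinearD(3,4) [OF f] algebra_simps)
    then have "Re (cinner u x) - Re (f x) = 0" by (rule quadratic_nonneg_imp_linear_zero)
    then show ?thesis using cinner_commute [of u x] by simp
  qed
  \<comment> \<open>complex linearity recovers the imaginary part from the real part at \<open>-\<i>x\<close>\<close>
  have "Im (f x) = Im (cinner x u)" for x
    using re [of "(- \<i>) *\<^sub>C x"]
    by (simp add: bounded_clinearD(2) [OF f] scaleC_complex_def cinner_scaleC_left)
  with re have "f x = cinner x u" for x by (simp add: complex_eq_iff)
  then show ?thesis by blast
qed

lemma cinner_cadjoint:
  fixes T :: "'a::{complex_inner, banach} \<Rightarrow> 'b::complex_inner"
  assumes T: "bounded_clinear T"
  shows "cinner (T x) y = cinner x (cadjoint T y)"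
proof -
  have "\<exists>u. \<forall>x. cinner (T x) y = cinner x u" for y
  proof (rule riesz_representation)
    note bl = bounded_clinearD(1) [OF T]
    have "bounded_linear (\<lambda>x. cinner (T x) y)"
    proof (rule bounded_linear_intro [where K = "onorm T * norm y"])
      fix x
      have "cmod (cinner (T x) y) \<le> norm (T x) * norm y" by (rule norm_cinner_le)
      also have "\<dots> \<le> (onorm T * norm x) * norm y" by (intro mult_right_mono onorm [OF bl]) simp
      finally show "cmod (cinner (T x) y) \<le> norm x * (onorm T * norm y)" by (simp add: mult_ac)
    qed (simp_all add: bounded_clinearD(3,4) [OF T] cinner_add_left cinner_scaleR_left scaleR_conv_of_real)
    then show "bounded_clinear (\<lambda>x. cinner (T x) y)"
      by (simp add: bounded_clinear_def bounded_clinearD(2) [OF T] cinner_scaleC_left scaleC_complex_def)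
  qed
  then have "\<exists>S. \<forall>x y. cinner (T x) y = cinner x (S y)" by metis
  then have "\<forall>x y. cinner (T x) y = cinner x (cadjoint T y)"
    unfolding cadjoint_def by (rule someI_ex)
  then show ?thesis by blast
qed

lemma cadjoint_eqI:
  fixes T :: "'a::{complex_inner, banach} \<Rightarrow> 'b::complex_inner"
  assumes "bounded_clinear T" "\<And>x y. cinner (T x) y = cinner x (S y)"
  shows "cadjoint T = S"
  by (rule ext, rule cinner_ext) (metis assms cinner_cadjoint)

text \<open>From \<open>\<parallel>T\<^sup>*y\<parallel>\<^sup>2 = \<langle>T T\<^sup>*y, y\<rangle>\<close> and Cauchy-Schwarz, one factor \<open>\<parallel>T\<^sup>*y\<parallel>\<close> cancels.\<close>

lemma cadjoint_norm_le:
  fixes T :: "'a::{complex_inner, banach} \<Rightarrow> 'b::complex_inner"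
  assumes T: "bounded_clinear T"
  shows "norm (cadjoint T y) \<le> onorm T * norm y"
proof (cases "cadjoint T y = 0")
  case True
  then show ?thesis
    by (simp add: onorm_pos_le [OF bounded_clinearD(1) [OF T]])
next
  case False
  let ?s = "cadjoint T y"
  have "complex_of_real ((norm ?s)\<^sup>2) = cinner (T ?s) y"
    by (metis cinner_cadjoint [OF T] cinner_self)
  then have "(norm ?s)\<^sup>2 = cmod (cinner (T ?s) y)"
    by (metis norm_of_real abs_of_nonneg zero_le_power2)
  also have "\<dots> \<le> norm (T ?s) * norm y" by (rule norm_cinner_le)
  also have "\<dots> \<le> (onorm T * norm ?s) * norm y"
    by (intro mult_right_mono onorm [OF bounded_clinearD(1) [OF T]]) simp
  finally have "norm ?s * norm ?s \<le> norm ?s * (onorm T * norm y)"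
    by (simp add: power2_eq_square mult_ac)
  with False show ?thesis by (simp add: mult_le_cancel_left)
qed

lemma bounded_clinear_cadjoint:
  fixes T :: "'a::{complex_inner, banach} \<Rightarrow> 'b::complex_inner"
  assumes T: "bounded_clinear T"
  shows "bounded_clinear (cadjoint T)"
proof -
  note adj = cinner_cadjoint [OF T, symmetric]
  have scale: "cadjoint T (c *\<^sub>C y) = c *\<^sub>C cadjoint T y" for c y
    by (rule cinner_ext) (simp add: adj cinner_scaleC_right)
  have "bounded_linear (cadjoint T)"
  proof (rule bounded_linear_intro [where K = "onorm T"])
    show "cadjoint T (x + y) = cadjoint T x + cadjoint T y" for x y
      by (rule cinner_ext) (simp add: adj cinner_add_right)
    show "cadjoint T (r *\<^sub>R x) = r *\<^sub>R cadjoint T x" for r x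
      by (simp add: scaleR_scaleC scale)
    show "norm (cadjoint T x) \<le> norm x * onorm T" for x
      using cadjoint_norm_le [OF T] by (simp add: mult.commute)
  qed
  then show ?thesis by (simp add: bounded_clinear_def scale)
qed

lemma cadjoint_cadjoint:
  fixes T :: "'a::{complex_inner, banach} \<Rightarrow> 'b::{complex_inner, banach}"
  assumes T: "bounded_clinear T"
  shows "cadjoint (cadjoint T) = T"
  by (rule cadjoint_eqI [OF bounded_clinear_cadjoint [OF T]])
    (metis cinner_cadjoint [OF T] cinner_commute)

lemma onorm_cadjoint:
  fixes T :: "'a::{complex_inner, banach} \<Rightarrow> 'b::{complex_inner, banach}"
  assumes T: "bounded_clinear T"
  shows "onorm (cadjoint T) = onorm T"
proof (rule antisym)
  show "onorm (cadjoint T) \<le> onorm T"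
    using cadjoint_norm_le [OF T] onorm_pos_le [OF bounded_clinearD(1) [OF T]]
    by (intro onorm_bound)
  have "norm (T x) \<le> onorm (cadjoint T) * norm x" for x
    using cadjoint_norm_le [OF bounded_clinear_cadjoint [OF T], of x] by (simp add: cadjoint_cadjoint [OF T])
  then show "onorm T \<le> onorm (cadjoint T)"
    using onorm_pos_le [OF bounded_clinearD(1) [OF bounded_clinear_cadjoint [OF T]]]
    by (intro onorm_bound)
qed

lemma cadjoint_add_scaleC:
  fixes T A :: "'a::{complex_inner, banach} \<Rightarrow> 'b::complex_inner"
  assumes "bounded_clinear T" "bounded_clinear A"
  shows "cadjoint (\<lambda>x. T x + c *\<^sub>C A x) = (\<lambda>y. cadjoint T y + cnj c *\<^sub>C cadjoint A y)"
  by (rule cadjoint_eqI [OF bounded_clinear_add_scaleC [OF assms]])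
    (simp add: cinner_add_left cinner_add_right cinner_scaleC_left cinner_scaleC_right
      cinner_cadjoint [OF assms(1)] cinner_cadjoint [OF assms(2)])

lemma onorm_cadjoint_add_scaleC:
  fixes T A :: "'a::{complex_inner, banach} \<Rightarrow> 'b::{complex_inner, banach}"
  assumes "bounded_clinear T" "bounded_clinear A"
  shows "onorm (\<lambda>y. cadjoint T y + c *\<^sub>C cadjoint A y) = onorm (\<lambda>x. T x + cnj c *\<^sub>C A x)"
  using onorm_cadjoint [OF bounded_clinear_add_scaleC [OF assms], of "cnj c"]
  by (simp add: cadjoint_add_scaleC [OF assms])

lemma birkhoff_james_cadjoint:
  fixes T A :: "'a::{complex_inner, banach} \<Rightarrow> 'a"
  assumes "bounded_clinear T" "bounded_clinear A" "birkhoff_james T A"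
  shows "birkhoff_james (cadjoint T) (cadjoint A)"
  using assms(3)
  by (simp add: birkhoff_james_def onorm_cadjoint_add_scaleC [OF assms(1,2)] onorm_cadjoint [OF assms(1)])

section \<open>Norming sequences in a prescribed direction\<close>

text \<open>With the squares, the error \<open>\<delta>\<close> may exceed \<open>\<parallel>S\<parallel>\<^sup>2\<close>, so the case of a small norm needs no
  separate treatment.\<close>

lemma onorm_square_approx:
  fixes S :: "'a::complex_inner \<Rightarrow> 'b::complex_inner"
  assumes S: "bounded_linear S" and ne: "(UNIV :: 'a set) \<noteq> {0}" and d: "\<delta> > 0"
  obtains x where "norm x = 1" "(norm (S x))\<^sup>2 > (onorm S)\<^sup>2 - \<delta>"
proof -
  have "\<exists>x. norm x = 1 \<and> (norm (S x))\<^sup>2 > (onorm S)\<^sup>2 - \<delta>"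
  proof (rule ccontr)
    assume "\<not> ?thesis"
    then have le: "norm x = 1 \<Longrightarrow> (norm (S x))\<^sup>2 \<le> (onorm S)\<^sup>2 - \<delta>" for x by force
    define b where "b = sqrt ((onorm S)\<^sup>2 - \<delta>)"
    obtain w :: 'a where "w \<noteq> 0" using ne by blast
    then have "norm ((1 / norm w) *\<^sub>R w) = 1" by simp
    from le [OF this] have pos: "0 \<le> (onorm S)\<^sup>2 - \<delta>"
      by (meson order_trans zero_le_power2)
    have "norm (S x) \<le> b * norm x" for x
    proof (cases "x = 0")
      case True
      then show ?thesis using S by (simp add: linear_simps)
    next
      case False
      then have "norm ((1 / norm x) *\<^sub>R x) = 1" by simp
      from le [OF this] have "norm (S ((1 / norm x) *\<^sub>R x)) \<le> b"
        unfolding b_def by (rule real_le_rsqrt)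
      moreover have "norm (S ((1 / norm x) *\<^sub>R x)) = norm (S x) / norm x"
        using S by (simp add: linear_simps)
      ultimately show ?thesis using False by (simp add: field_simps)
    qed
    then have "onorm S \<le> b"
      using pos by (intro onorm_bound) (auto simp: b_def)
    then have "(onorm S)\<^sup>2 \<le> b\<^sup>2"
      using onorm_pos_le [OF S] by (intro power_mono) auto
    then show False using pos d by (simp add: b_def)
  qed
  then show ?thesis using that by blast
qed

text \<open>Unit vectors that almost attain the norm of \<open>T + (z/n)A\<close>, which is at least \<open>\<parallel>T\<parallel>\<close>, must
  almost attain the norm of \<open>T\<close>; comparing the expansion of \<open>\<parallel>Tx + (z/n)Ax\<parallel>\<^sup>2\<close> with
  \<open>\<parallel>T\<parallel>\<^sup>2 \<ge> \<parallel>Tx\<parallel>\<^sup>2\<close> leaves only a term of order \<open>1/n\<close> for the cross term to be negative.\<close>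

lemma birkhoff_james_norming_sequence:
  fixes T A :: "'a::complex_inner \<Rightarrow> 'a"
  assumes ne: "(UNIV :: 'a set) \<noteq> {0}"
    and T: "bounded_clinear T" and A: "bounded_clinear A" and bj: "birkhoff_james T A"
  obtains x C where "norming_sequence T x"
    "\<And>n. Re (cnj z * cinner (T (x n)) (A (x n))) \<ge> - C * inverse (real (Suc n))"
proof -
  note blT = bounded_clinearD(1) [OF T] and blA = bounded_clinearD(1) [OF A]
  define t where "t n = inverse (real (Suc n))" for n
  have t: "t n > 0" "t n \<le> 1" for n by (auto simp: t_def field_simps)
  define S where "S n x = T x + (of_real (t n) * z) *\<^sub>C A x" for n x
  have "\<exists>x. norm x = 1 \<and> (norm (S n x))\<^sup>2 > (onorm T)\<^sup>2 - (t n)\<^sup>2" for n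
  proof -
    have "bounded_linear (S n)"
      unfolding S_def by (rule bounded_clinearD(1) [OF bounded_clinear_add_scaleC [OF T A]])
    from onorm_square_approx [OF this ne, of "(t n)\<^sup>2"] t [of n]
    obtain x where x: "norm x = 1" "(norm (S n x))\<^sup>2 > (onorm (S n))\<^sup>2 - (t n)\<^sup>2" by auto
    have "onorm T \<le> onorm (S n)"
      using bj unfolding birkhoff_james_def S_def by blast
    then have "(onorm T)\<^sup>2 \<le> (onorm (S n))\<^sup>2"
      using onorm_pos_le [OF blT] by (intro power_mono) auto
    with x show ?thesis by force
  qed
  then obtain x where x: "\<And>n. norm (x n) = 1"
    and xS: "\<And>n. (norm (S n (x n)))\<^sup>2 > (onorm T)\<^sup>2 - (t n)\<^sup>2" by metis
  have Tx: "norm (T (x n)) \<le> onorm T" and Ax: "norm (A (x n)) \<le> onorm A" for n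
    using onorm [OF blT, of "x n"] onorm [OF blA, of "x n"] x by simp_all
  define R where "R n = Re (cnj z * cinner (T (x n)) (A (x n)))" for n
  define C where "C = 1 + (cmod z)\<^sup>2 * (onorm A)\<^sup>2"
  have expand: "(onorm T)\<^sup>2 < (norm (T (x n)))\<^sup>2 + (t n)\<^sup>2 * C + 2 * t n * R n" for n
  proof -
    have "(norm (S n (x n)))\<^sup>2 = (norm (T (x n)))\<^sup>2 + (t n * cmod z)\<^sup>2 * (norm (A (x n)))\<^sup>2 + 2 * t n * R n"
      unfolding S_def norm_add_scaleC_square R_def using t [of n] by (simp add: norm_mult algebra_simps)
    moreover have "(t n * cmod z)\<^sup>2 * (norm (A (x n)))\<^sup>2 \<le> (t n * cmod z)\<^sup>2 * (onorm A)\<^sup>2"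
      using Ax by (intro mult_left_mono power_mono) auto
    ultimately show ?thesis
      using xS [of n] by (simp add: C_def power_mult_distrib algebra_simps)
  qed
  have lower: "R n \<ge> - C * t n" for n
  proof -
    have "(norm (T (x n)))\<^sup>2 \<le> (onorm T)\<^sup>2" using Tx by (intro power_mono) auto
    then have "0 < t n * (t n * C + 2 * R n)"
      using expand [of n] by (simp add: power2_eq_square algebra_simps)
    then have "0 < t n * C + 2 * R n" using t [of n] by (simp add: zero_less_mult_iff)
    moreover have "0 \<le> t n * C" using t [of n] by (simp add: C_def)
    ultimately show ?thesis by (simp add: mult.commute)
  qed
  have upper: "R n \<le> cmod z * (onorm T * onorm A)" for n
  proof -
    have "R n \<le> cmod (cnj z * cinner (T (x n)) (A (x n)))"
      unfolding R_def by (rule complex_Re_le_cmod)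
    also have "\<dots> \<le> cmod z * (norm (T (x n)) * norm (A (x n)))"
      by (simp add: norm_mult mult_left_mono norm_cinner_le)
    also have "\<dots> \<le> cmod z * (onorm T * onorm A)"
      using Tx Ax onorm_pos_le [OF blT] by (intro mult_left_mono mult_mono) auto
    finally show ?thesis .
  qed
  have t0: "t \<longlonglongrightarrow> 0"
    unfolding t_def by (rule LIMSEQ_inverse_real_of_nat)
  define M where "M = cmod z * (onorm T * onorm A)"
  have "(\<lambda>n. (norm (T (x n)))\<^sup>2) \<longlonglongrightarrow> (onorm T)\<^sup>2"
  proof (rule tendsto_sandwich)
    have "(onorm T)\<^sup>2 - (t n)\<^sup>2 * C - 2 * t n * M \<le> (norm (T (x n)))\<^sup>2" for n
    proof -
      have "2 * t n * R n \<le> 2 * t n * M"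
        using t [of n] upper [of n] by (intro mult_left_mono) (auto simp: M_def)
      then show ?thesis using expand [of n] by linarith
    qed
    then show "\<forall>\<^sub>F n in sequentially. (onorm T)\<^sup>2 - (t n)\<^sup>2 * C - 2 * t n * M \<le> (norm (T (x n)))\<^sup>2"
      by simp
    have "(\<lambda>n. (onorm T)\<^sup>2 - (t n)\<^sup>2 * C - 2 * t n * M) \<longlonglongrightarrow> (onorm T)\<^sup>2 - 0\<^sup>2 * C - 2 * 0 * M"
      by (intro tendsto_intros t0)
    then show "(\<lambda>n. (onorm T)\<^sup>2 - (t n)\<^sup>2 * C - 2 * t n * M) \<longlonglongrightarrow> (onorm T)\<^sup>2" by simp
    show "\<forall>\<^sub>F n in sequentially. (norm (T (x n)))\<^sup>2 \<le> (onorm T)\<^sup>2"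
      using Tx by (auto intro!: always_eventually power_mono)
  qed auto
  then have "(\<lambda>n. sqrt ((norm (T (x n)))\<^sup>2)) \<longlonglongrightarrow> sqrt ((onorm T)\<^sup>2)"
    by (rule tendsto_real_sqrt)
  then have "norming_sequence T x"
    using x onorm_pos_le [OF blT] by (simp add: norming_sequence_def)
  with lower show ?thesis
    using that unfolding R_def t_def by blast
qed

section \<open>Isometries whose compressions are Birkhoff-James orthogonal\<close>

lemma onorm_isometry:
  fixes U :: "'a::complex_inner \<Rightarrow> 'b::complex_inner"
  assumes bl: "bounded_linear U" and iso: "\<And>x. norm (U x) = norm x"
    and ne: "(UNIV :: 'a set) \<noteq> {0}"
  shows "onorm U = 1"
proof (rule antisym)
  show "onorm U \<le> 1" by (rule onorm_bound) (simp_all add: iso)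
  obtain w :: 'a where "w \<noteq> 0" using ne by blast
  then show "1 \<le> onorm U" using onorm [OF bl, of w] by (simp add: iso)
qed

lemma onorm_scaleC_isometry:
  fixes U :: "'a::complex_inner \<Rightarrow> 'b::complex_inner"
  assumes bl: "bounded_linear U" and iso: "\<And>x. norm (U x) = norm x"
    and ne: "(UNIV :: 'a set) \<noteq> {0}"
  shows "onorm (\<lambda>x. c *\<^sub>C U x) = cmod c"
proof (rule antisym)
  show "onorm (\<lambda>x. c *\<^sub>C U x) \<le> cmod c" by (rule onorm_bound) (simp_all add: norm_scaleC iso)
  obtain w :: 'a where "w \<noteq> 0" using ne by blast
  then show "cmod c \<le> onorm (\<lambda>x. c *\<^sub>C U x)"
    using onorm [OF bounded_linear_compose [OF bounded_linear_scaleC bl], of c w]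
    by (simp add: norm_scaleC iso)
qed

text \<open>Polarization: the norms of all \<open>x + cy\<close> determine the inner product of \<open>x\<close> and \<open>y\<close>.\<close>

lemma isometry_cinner:
  fixes J :: "'h::complex_inner \<Rightarrow> 'k::complex_inner"
  assumes "isometric_embedding J"
  shows "cinner (J x) (J y) = cinner x y"
proof -
  have J: "bounded_clinear J" and nJ: "norm (J x) = norm x" for x
    using assms by (auto simp: isometric_embedding_def)
  have "Re (cnj c * cinner (J x) (J y)) = Re (cnj c * cinner x y)" for c
    using nJ [of "x + c *\<^sub>C y"] norm_add_scaleC_square [of x c y]
      norm_add_scaleC_square [of "J x" c "J y"]
    by (simp add: bounded_clinearD(2,3) [OF J] nJ)
  from this [of 1] this [of "\<i>"] show ?thesis
    by (simp add: complex_eq_iff)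
qed

lemma cadjoint_isometry:
  fixes J :: "'h::{complex_inner, banach} \<Rightarrow> 'k::complex_inner"
  assumes "isometric_embedding J"
  shows "cadjoint J (J x) = x"
  by (rule cinner_ext)
    (metis assms isometric_embedding_def cinner_cadjoint isometry_cinner)

text \<open>This identifies the projection with \<open>JJ\<^sup>*\<close>, which makes a compression to the range of \<open>J\<close> an
  operator \<open>J\<^sup>*UJ\<close> on \<open>H\<close> itself.\<close>

lemma orth_proj_range:
  fixes J :: "'h::{complex_inner, banach} \<Rightarrow> 'k::complex_inner"
  assumes "isometric_embedding J"
  shows "orth_proj (range J) y = J (cadjoint J y)"
proof -
  have J: "bounded_clinear J" using assms by (simp add: isometric_embedding_def)
  have orth: "cinner (y - J q) (J m) = cnj (cinner m (cadjoint J y) - cinner m q)" for q m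
    by (metis J assms cinner_cadjoint cinner_commute cinner_diff_right isometry_cinner)
  show ?thesis
    unfolding orth_proj_def
  proof (rule the_equality)
    show "J (cadjoint J y) \<in> range J \<and> (\<forall>m\<in>range J. cinner (y - J (cadjoint J y)) m = 0)"
      by (auto simp: orth)
    fix p assume p: "p \<in> range J \<and> (\<forall>m\<in>range J. cinner (y - p) m = 0)"
    then obtain q where q: "p = J q" by blast
    have "cinner m q = cinner m (cadjoint J y)" for m
      using p orth [of q m] by (auto simp: q)
    then show "p = J (cadjoint J y)" using q cinner_ext by blast
  qed
qed

text \<open>Cauchy-Schwarz in the orthogonal complement of the range of \<open>J\<close>.\<close>

lemma cinner_compression_error:
  fixes J :: "'h::{complex_inner, banach} \<Rightarrow> 'k::complex_inner"
  assumes J: "isometric_embedding J"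
  shows "cmod (cinner u v - cinner (cadjoint J u) (cadjoint J v))
    \<le> sqrt ((norm u)\<^sup>2 - (norm (cadjoint J u))\<^sup>2) * sqrt ((norm v)\<^sup>2 - (norm (cadjoint J v))\<^sup>2)"
proof -
  let ?Q = "cadjoint J"
  have bJ: "bounded_clinear J" using J by (simp add: isometric_embedding_def)
  have defect: "cinner (u - J (?Q u)) (v - J (?Q v)) = cinner u v - cinner (?Q u) (?Q v)" for u v
    using cinner_commute [of u "J (?Q v)"] cinner_commute [of "?Q u" "?Q v"]
    by (simp add: cinner_diff_left cinner_diff_right cadjoint_isometry [OF J] cinner_cadjoint [OF bJ])
  have "complex_of_real ((norm (u - J (?Q u)))\<^sup>2) = of_real ((norm u)\<^sup>2 - (norm (?Q u))\<^sup>2)" for u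
    using defect [of u u] by (simp add: cinner_self)
  then have "(norm (u - J (?Q u)))\<^sup>2 = (norm u)\<^sup>2 - (norm (?Q u))\<^sup>2" for u
    by (simp only: of_real_eq_iff)
  then have "norm (u - J (?Q u)) = sqrt ((norm u)\<^sup>2 - (norm (?Q u))\<^sup>2)" for u
    by (metis norm_ge_zero real_sqrt_unique)
  then show ?thesis
    using norm_cinner_le [of "u - J (?Q u)" "v - J (?Q v)"] by (simp add: defect)
qed

lemma compression_norm_le:
  fixes J :: "'h::{complex_inner, banach} \<Rightarrow> 'k::complex_inner"
  assumes J: "isometric_embedding J" and "\<rho> > 0" and U: "\<And>y. norm (U y) = norm y"
    and T: "\<And>x. T x = \<rho> *\<^sub>R cadjoint J (U (J x))"
  shows "norm (T x) \<le> \<rho> * norm x"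
proof -
  have bJ: "bounded_clinear J" and nJ: "norm (J x) = norm x" for x
    using J by (auto simp: isometric_embedding_def)
  have "onorm J \<le> 1" by (rule onorm_bound) (simp_all add: nJ)
  then have "onorm J * norm (U (J x)) \<le> 1 * norm (U (J x))" by (intro mult_right_mono) auto
  then have "norm (cadjoint J (U (J x))) \<le> norm x"
    using cadjoint_norm_le [OF bJ, of "U (J x)"] U nJ by simp
  then show ?thesis using \<open>\<rho> > 0\<close> by (simp add: T)
qed

text \<open>The set whose supremum defines \<open>\<eta>\<close> is bounded by \<open>1\<close>, so each of its elements is at most
  the supremum.\<close>

lemma eta_upper:
  assumes "norming_sequence T x" "\<zeta> \<ge> 0"
    and "(\<lambda>n. sqrt (1 - (norm (A (x n)))\<^sup>2 / \<rho>\<^sup>2)) \<longlonglongrightarrow> \<zeta>"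
  shows "\<zeta> \<le> eta \<rho> T A"
  unfolding eta_def
proof (rule cSup_upper)
  show "\<zeta> \<in> {\<zeta>. \<zeta> \<ge> 0 \<and> (\<exists>x. norming_sequence T x \<and>
      (\<lambda>n. sqrt (1 - (norm (A (x n)))\<^sup>2 / \<rho>\<^sup>2)) \<longlonglongrightarrow> \<zeta>)}"
    using assms by blast
  have "c \<le> 1" if "(\<lambda>n. sqrt (1 - (norm (A (x n)))\<^sup>2 / \<rho>\<^sup>2)) \<longlonglongrightarrow> c" for c x
    using that by (rule LIMSEQ_le_const2) simp
  then show "bdd_above {\<zeta>. \<zeta> \<ge> 0 \<and> (\<exists>x. norming_sequence T x \<and>
      (\<lambda>n. sqrt (1 - (norm (A (x n)))\<^sup>2 / \<rho>\<^sup>2)) \<longlonglongrightarrow> \<zeta>)}"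
    by (auto intro: bdd_aboveI [where M = 1])
qed

text \<open>The sequence is taken in direction \<open>z\<close>, so it depends on \<open>z\<close>, but the bound on the limit of the
  defects does not. Isometries \<open>U\<close>, \<open>V\<close> that compress to \<open>T/\<rho>\<close>, \<open>A/\<rho>\<close> are the hypothesis because the
  adjoints of such unitaries again compress to the adjoints of \<open>T/\<rho>\<close>, \<open>A/\<rho>\<close>.\<close>

lemma approx_birkhoff_james_compression:
  fixes J :: "'h::{complex_inner, banach} \<Rightarrow> 'k::complex_inner"
  assumes ne: "(UNIV :: 'h set) \<noteq> {0}" and \<rho>: "\<rho> > 0"
    and T: "bounded_clinear T" and A: "bounded_clinear A"
    and J: "isometric_embedding J"
    and U: "bounded_clinear U" "\<And>y. norm (U y) = norm y"
    and V: "bounded_clinear V" "\<And>y. norm (V y) = norm y"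
    and TU: "\<And>x. T x = \<rho> *\<^sub>R cadjoint J (U (J x))"
    and AV: "\<And>x. A x = \<rho> *\<^sub>R cadjoint J (V (J x))"
    and bj: "birkhoff_james T A"
    and \<epsilon>: "eta \<rho> T A * sqrt (1 - (onorm T)\<^sup>2 / \<rho>\<^sup>2) \<le> \<epsilon>"
  shows "approx_birkhoff_james \<epsilon> U V"
proof -
  have nJ: "norm (J x) = norm x" for x
    using J by (simp add: isometric_embedding_def)
  obtain w :: 'h where "w \<noteq> 0" using ne by blast
  then have "J w \<noteq> 0" by (metis nJ norm_eq_zero)
  then have neK: "(UNIV :: 'k set) \<noteq> {0}" by blast
  have "(onorm (\<lambda>y. U y + z *\<^sub>C V y))\<^sup>2 \<ge> 1 - 2 * \<epsilon> * cmod z" for z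
  proof -
    obtain x C where x: "norming_sequence T x"
      and lower: "\<And>n. Re (cnj z * cinner (T (x n)) (A (x n))) \<ge> - C * inverse (real (Suc n))"
      using birkhoff_james_norming_sequence [OF ne T A bj] by blast
    \<comment> \<open>the lengths of the components of \<open>U (J (x n))\<close> and \<open>V (J (x n))\<close> orthogonal to the range of \<open>J\<close>\<close>
    define a where "a n = sqrt (1 - (norm (T (x n)))\<^sup>2 / \<rho>\<^sup>2)" for n
    define b where "b n = sqrt (1 - (norm (A (x n)))\<^sup>2 / \<rho>\<^sup>2)" for n
    have x1: "norm (x n) = 1" for n using x by (simp add: norming_sequence_def)
    have b01: "0 \<le> b n \<and> b n \<le> 1" for n
    proof -
      have "norm (A (x n)) \<le> \<rho>"
        using compression_norm_le [OF J \<rho> V(2) AV, of "x n"] x1 by simp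
      then have "(norm (A (x n)))\<^sup>2 \<le> \<rho>\<^sup>2" by (intro power_mono) auto
      then show ?thesis using \<rho> by (simp add: b_def)
    qed
    have "bounded (range b)"
      by (rule boundedI [where B = 1]) (use b01 in auto)
    then obtain \<zeta> r where r: "strict_mono r" and \<zeta>: "(b \<circ> r) \<longlonglongrightarrow> \<zeta>"
      using bounded_imp_convergent_subsequence by blast
    have \<zeta>0: "\<zeta> \<ge> 0"
      using \<zeta> by (rule LIMSEQ_le_const) (use b01 in auto)
    have Tlim: "(\<lambda>n. norm (T (x n))) \<longlonglongrightarrow> onorm T"
      using x by (simp add: norming_sequence_def)
    have "norming_sequence T (x \<circ> r)"
      using x1 LIMSEQ_subseq_LIMSEQ [OF Tlim r] by (simp add: norming_sequence_def o_def)
    then have \<zeta>eta: "\<zeta> \<le> eta \<rho> T A"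
      using eta_upper [OF _ \<zeta>0] \<zeta> by (simp add: b_def o_def)
    have alim: "a \<longlonglongrightarrow> sqrt (1 - (onorm T)\<^sup>2 / \<rho>\<^sup>2)"
      unfolding a_def by (intro tendsto_intros Tlim) (use \<rho> in auto)
    have est: "1 - 2 * (C * inverse (real (Suc n)) / \<rho>\<^sup>2) - 2 * cmod z * (a n * b n)
        \<le> (onorm (\<lambda>y. U y + z *\<^sub>C V y))\<^sup>2" for n
    proof -
      let ?u = "U (J (x n))" and ?v = "V (J (x n))" and ?Q = "cadjoint J"
      have nu: "norm ?u = 1" "norm ?v = 1" by (simp_all add: U V nJ x1)
      have QT: "?Q ?u = (1 / \<rho>) *\<^sub>R T (x n)" "?Q ?v = (1 / \<rho>) *\<^sub>R A (x n)"
        using \<rho> by (simp_all add: TU AV)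
      define d where "d = cinner ?u ?v - cinner (?Q ?u) (?Q ?v)"
      have "cmod d \<le> a n * b n"
        using cinner_compression_error [OF J, of ?u ?v] \<rho>
        unfolding d_def nu QT by (simp add: a_def b_def power_divide)
      then have "cmod (cnj z * d) \<le> cmod z * (a n * b n)"
        by (simp add: norm_mult mult_left_mono)
      then have "- (cmod z * (a n * b n)) \<le> Re (cnj z * d)"
        using abs_Re_le_cmod [of "cnj z * d"] by linarith
      moreover have "Re (cnj z * cinner ?u ?v) = Re (cnj z * d) + Re (cnj z * cinner (T (x n)) (A (x n))) / \<rho>\<^sup>2"
      proof -
        have "cinner (?Q ?u) (?Q ?v) = of_real (1 / \<rho>\<^sup>2) * cinner (T (x n)) (A (x n))"
          by (simp add: QT cinner_scaleR_left cinner_scaleR_right power2_eq_square)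
        then have "cnj z * cinner ?u ?v = cnj z * d + of_real (1 / \<rho>\<^sup>2) * (cnj z * cinner (T (x n)) (A (x n)))"
          by (simp add: d_def algebra_simps)
        moreover have "Re (of_real (1 / \<rho>\<^sup>2) * w) = Re w / \<rho>\<^sup>2" for w
          by simp
        ultimately show ?thesis by (simp only: plus_complex.sel)
      qed
      moreover have "- (C * inverse (real (Suc n)) / \<rho>\<^sup>2) \<le> Re (cnj z * cinner (T (x n)) (A (x n))) / \<rho>\<^sup>2"
        using divide_right_mono [OF lower [of n], of "\<rho>\<^sup>2"] by simp
      moreover have "(norm (?u + z *\<^sub>C ?v))\<^sup>2 = 1 + (cmod z)\<^sup>2 + 2 * Re (cnj z * cinner ?u ?v)"
        by (simp add: norm_add_scaleC_square nu)
      moreover have "norm (?u + z *\<^sub>C ?v) \<le> onorm (\<lambda>y. U y + z *\<^sub>C V y)"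
        using onorm [OF bounded_clinearD(1) [OF bounded_clinear_add_scaleC [OF U(1) V(1), of z]], of "J (x n)"]
        by (simp add: nJ x1)
      then have "(norm (?u + z *\<^sub>C ?v))\<^sup>2 \<le> (onorm (\<lambda>y. U y + z *\<^sub>C V y))\<^sup>2"
        by (intro power_mono) auto
      ultimately show ?thesis using zero_le_power2 [of "cmod z"] by linarith
    qed
    have "((\<lambda>n. 1 - 2 * (C * inverse (real (Suc n)) / \<rho>\<^sup>2) - 2 * cmod z * (a n * b n)) \<circ> r)
        \<longlonglongrightarrow> 1 - 2 * (C * 0 / \<rho>\<^sup>2) - 2 * cmod z * (sqrt (1 - (onorm T)\<^sup>2 / \<rho>\<^sup>2) * \<zeta>)"
      using LIMSEQ_subseq_LIMSEQ [OF alim r] \<zeta>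
        LIMSEQ_subseq_LIMSEQ [OF LIMSEQ_inverse_real_of_nat r]
      unfolding o_def by (intro tendsto_intros) (use \<rho> in auto)
    then have "1 - 2 * cmod z * (sqrt (1 - (onorm T)\<^sup>2 / \<rho>\<^sup>2) * \<zeta>) \<le> (onorm (\<lambda>y. U y + z *\<^sub>C V y))\<^sup>2"
      using est by (auto intro: LIMSEQ_le_const2)
    moreover have "sqrt (1 - (onorm T)\<^sup>2 / \<rho>\<^sup>2) * \<zeta> \<le> \<epsilon>"
    proof -
      have "onorm T \<le> \<rho>"
        using compression_norm_le [OF J \<rho> U(2) TU] \<rho> by (intro onorm_bound) auto
      then have "(onorm T)\<^sup>2 \<le> \<rho>\<^sup>2"
        using onorm_pos_le [OF bounded_clinearD(1) [OF T]] by (intro power_mono)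
      then have "0 \<le> sqrt (1 - (onorm T)\<^sup>2 / \<rho>\<^sup>2)" using \<rho> by simp
      then show ?thesis
        using mult_left_mono [OF \<zeta>eta] \<epsilon> by (metis mult.commute order_trans)
    qed
    then have "2 * cmod z * (sqrt (1 - (onorm T)\<^sup>2 / \<rho>\<^sup>2) * \<zeta>) \<le> 2 * cmod z * \<epsilon>"
      by (intro mult_left_mono) auto
    ultimately show ?thesis by (simp add: mult_ac)
  qed
  then show ?thesis
    unfolding approx_birkhoff_james_def
      onorm_isometry [OF bounded_clinearD(1) [OF U(1)] U(2) neK]
      onorm_scaleC_isometry [OF bounded_clinearD(1) [OF V(1)] V(2) neK]
    by simp
qed

section \<open>Unitary dilations\<close>

lemma unitaryD:
  fixes U :: "'k::{complex_inner, banach} \<Rightarrow> 'k"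
  assumes "unitary U"
  shows "bounded_clinear U" "norm (U x) = norm x"
    "bounded_clinear (cadjoint U)" "norm (cadjoint U x) = norm x"
proof -
  show U: "bounded_clinear U" using assms by (simp add: unitary_def)
  have inv: "cadjoint U (U x) = x" "U (cadjoint U x) = x" for x
    using assms by (auto simp: unitary_def fun_eq_iff)
  have iso: "norm (U x) = norm x" for x
  proof -
    have "complex_of_real ((norm (U x))\<^sup>2) = of_real ((norm x)\<^sup>2)"
      unfolding cinner_self [symmetric] cinner_cadjoint [OF U] inv ..
    then show ?thesis by (simp only: of_real_eq_iff power2_eq_iff_nonneg norm_ge_zero)
  qed
  then show "norm (U x) = norm x" .
  show "bounded_clinear (cadjoint U)" by (rule bounded_clinear_cadjoint [OF U])
  show "norm (cadjoint U x) = norm x"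
    using iso [of "cadjoint U x"] by (simp add: inv)
qed

lemma unitary_dilation_compression:
  fixes J :: "'h::{complex_inner, banach} \<Rightarrow> 'k::complex_inner"
  assumes J: "isometric_embedding J" and dil: "unitary_dilation J \<rho> T U"
  shows "T x = \<rho> *\<^sub>R cadjoint J (U (J x))"
proof -
  have "J ((T ^^ 1) x) = \<rho> *\<^sub>R orth_proj (range J) ((U ^^ 1) (J x))"
    using dil unfolding unitary_dilation_def by blast
  then have "J (T x) = J (\<rho> *\<^sub>R cadjoint J (U (J x)))"
    using J by (simp add: orth_proj_range [OF J] isometric_embedding_def bounded_clinearD(4))
  then show ?thesis by (metis cadjoint_isometry [OF J])
qed

lemma cadjoint_compression:
  fixes J :: "'h::{complex_inner, banach} \<Rightarrow> 'k::{complex_inner, banach}"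
  assumes J: "bounded_clinear J" and T: "bounded_clinear T" and U: "bounded_clinear U"
    and TU: "\<And>x. T x = \<rho> *\<^sub>R cadjoint J (U (J x))"
  shows "cadjoint T x = \<rho> *\<^sub>R cadjoint J (cadjoint U (J x))"
proof -
  have "cinner (T x) y = cinner x (\<rho> *\<^sub>R cadjoint J (cadjoint U (J y)))" for x y
  proof -
    have "cinner (cadjoint J (U (J x))) y = cinner (U (J x)) (J y)"
      by (metis J cinner_cadjoint cinner_commute)
    also have "\<dots> = cinner x (cadjoint J (cadjoint U (J y)))"
      by (simp add: cinner_cadjoint [OF U] cinner_cadjoint [OF J])
    finally show ?thesis by (simp add: TU cinner_scaleR_left cinner_scaleR_right)
  qed
  then show ?thesis by (simp add: cadjoint_eqI [OF T])
qed

lemma approx_birkhoff_james_zero_imp: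
  fixes U V :: "'a::complex_inner \<Rightarrow> 'a"
  assumes "bounded_clinear U" "bounded_clinear V" "approx_birkhoff_james 0 U V"
  shows "birkhoff_james U V"
  unfolding birkhoff_james_def
proof
  fix z
  have "(onorm U)\<^sup>2 \<le> (onorm (\<lambda>x. U x + z *\<^sub>C V x))\<^sup>2"
    using assms(3) by (simp add: approx_birkhoff_james_def)
  then show "onorm U \<le> onorm (\<lambda>x. U x + z *\<^sub>C V x)"
    by (rule power2_le_imp_le)
      (rule onorm_pos_le [OF bounded_clinearD(1) [OF bounded_clinear_add_scaleC [OF assms(1,2)]]])
qed

lemma approx_birkhoff_james_cadjointD:
  fixes U V :: "'a::{complex_inner, banach} \<Rightarrow> 'a"
  assumes U: "bounded_clinear U" and V: "bounded_clinear V"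
    and adj: "approx_birkhoff_james \<epsilon> (cadjoint U) (cadjoint V)"
  shows "approx_birkhoff_james \<epsilon> U V"
  unfolding approx_birkhoff_james_def
proof
  fix z
  \<comment> \<open>the multiple \<open>zV\<close> is the case of a vanishing first summand in \<open>onorm_cadjoint_add_scaleC\<close>\<close>
  have zero: "bounded_clinear (\<lambda>x::'a. 0::'a)"
    by (simp add: bounded_clinear_def)
  have "cadjoint (\<lambda>x::'a. 0::'a) = (\<lambda>x. 0)"
    by (rule cadjoint_eqI [OF zero]) (metis cinner_commute cinner_zero_left complex_cnj_zero)
  then have "onorm (\<lambda>x. cnj z *\<^sub>C cadjoint V x) = onorm (\<lambda>x. z *\<^sub>C V x)"
    using onorm_cadjoint_add_scaleC [OF zero V, of "cnj z"] by simp
  then show "(onorm (\<lambda>x. U x + z *\<^sub>C V x))\<^sup>2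
      \<ge> (onorm U)\<^sup>2 - 2 * \<epsilon> * onorm U * onorm (\<lambda>x. z *\<^sub>C V x)"
    using adj [unfolded approx_birkhoff_james_def, rule_format, of "cnj z"]
    by (simp add: onorm_cadjoint_add_scaleC [OF U V] onorm_cadjoint [OF U])
qed

text \<open>Along norming sequences of \<open>A\<close> the defect \<open>1 - \<parallel>Ax\<^sub>n\<parallel>\<^sup>2/\<rho>\<^sup>2\<close> tends to \<open>0\<close>. The existence of a norming
  sequence of \<open>T\<close> matters: the supremum of the empty set is unspecified.\<close>

lemma eta_nonpos:
  fixes T A :: "'h::complex_inner \<Rightarrow> 'h"
  assumes "\<rho> > 0" "onorm A = \<rho>" "norming_sequence T x"
    and "\<And>x. norming_sequence T x \<Longrightarrow> norming_sequence A x"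
  shows "eta \<rho> T A \<le> 0"
proof -
  have lim: "(\<lambda>n. sqrt (1 - (norm (A (y n)))\<^sup>2 / \<rho>\<^sup>2)) \<longlonglongrightarrow> 0" if "norming_sequence T y" for y
  proof -
    have "(\<lambda>n. norm (A (y n))) \<longlonglongrightarrow> \<rho>"
      using assms(2,4) that by (auto simp: norming_sequence_def)
    then have "(\<lambda>n. sqrt (1 - (norm (A (y n)))\<^sup>2 / \<rho>\<^sup>2)) \<longlonglongrightarrow> sqrt (1 - \<rho>\<^sup>2 / \<rho>\<^sup>2)"
      by (intro tendsto_intros) (use assms(1) in auto)
    then show ?thesis using assms(1) by simp
  qed
  show ?thesis
    unfolding eta_def
  proof (rule cSup_least)
    show "{\<zeta>. \<zeta> \<ge> 0 \<and> (\<exists>x. norming_sequence T x \<and>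
        (\<lambda>n. sqrt (1 - (norm (A (x n)))\<^sup>2 / \<rho>\<^sup>2)) \<longlonglongrightarrow> \<zeta>)} \<noteq> {}"
      (is "?Z \<noteq> {}")
    proof -
      have "0 \<in> ?Z" using assms(3) lim [OF assms(3)] by blast
      then show ?thesis by blast
    qed
    fix \<zeta>
    assume "\<zeta> \<in> {\<zeta>. \<zeta> \<ge> 0 \<and> (\<exists>x. norming_sequence T x \<and>
        (\<lambda>n. sqrt (1 - (norm (A (x n)))\<^sup>2 / \<rho>\<^sup>2)) \<longlonglongrightarrow> \<zeta>)}"
    then obtain y where "norming_sequence T y"
      and "(\<lambda>n. sqrt (1 - (norm (A (y n)))\<^sup>2 / \<rho>\<^sup>2)) \<longlonglongrightarrow> \<zeta>" by blast
    then show "\<zeta> \<le> 0" using lim LIMSEQ_unique by force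
  qed
qed

theorem theorem5p2:
  fixes T A :: "'h::separable_chilbert \<Rightarrow> 'h"
    and J :: "'h \<Rightarrow> 'k::separable_chilbert"
    and \<rho> :: real
  assumes "(UNIV :: 'h set) \<noteq> {0}"
    and "bounded_clinear T" and "bounded_clinear A"
    and "\<rho> > 0"
    and "T \<in> zeta_class TYPE('m::separable_chilbert) \<rho>"
    and "A \<in> zeta_class TYPE('n::separable_chilbert) \<rho>"
    and "isometric_embedding J"
    and "\<exists>U. unitary_dilation J \<rho> T U"
    and "\<exists>U. unitary_dilation J \<rho> A U"
    and "birkhoff_james T A"
  shows "\<forall>U\<^sub>T U\<^sub>A. unitary_dilation J \<rho> T U\<^sub>T \<and> unitary_dilation J \<rho> A U\<^sub>A \<longrightarrow>
      (\<forall>\<epsilon>. kappa \<rho> T A \<le> \<epsilon> \<and> \<epsilon> < 1 \<longrightarrow> approx_birkhoff_james \<epsilon> U\<^sub>T U\<^sub>A) \<and>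
      (onorm T = \<rho> \<longrightarrow> birkhoff_james U\<^sub>T U\<^sub>A) \<and>
      (onorm A = \<rho> \<and>
        ((\<forall>x. norming_sequence T x \<longrightarrow> norming_sequence A x) \<or>
         (\<forall>x. norming_sequence (cadjoint T) x \<longrightarrow> norming_sequence (cadjoint A) x))
        \<longrightarrow> birkhoff_james U\<^sub>T U\<^sub>A)"
proof (intro allI impI)
  fix U V :: "'k \<Rightarrow> 'k"
  assume UV: "unitary_dilation J \<rho> T U \<and> unitary_dilation J \<rho> A V"
  note ne = assms(1) and T = assms(2) and A = assms(3) and \<rho> = assms(4) and J = assms(7) and bj = assms(10)
  have bJ: "bounded_clinear J" using J by (simp add: isometric_embedding_def)
  have U: "unitary U" and V: "unitary V"
    using UV by (auto simp: unitary_dilation_def)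
  have TU: "T x = \<rho> *\<^sub>R cadjoint J (U (J x))" and AV: "A x = \<rho> *\<^sub>R cadjoint J (V (J x))" for x
    using UV unitary_dilation_compression [OF J] by blast+
  note T' = bounded_clinear_cadjoint [OF T] and A' = bounded_clinear_cadjoint [OF A]
  let ?s = "sqrt (1 - (onorm T)\<^sup>2 / \<rho>\<^sup>2)"
  let ?\<eta> = "eta \<rho> T A" and ?\<eta>' = "eta \<rho> (cadjoint T) (cadjoint A)"
  have direct: "approx_birkhoff_james \<epsilon> U V" if "?\<eta> * ?s \<le> \<epsilon>" for \<epsilon>
    using approx_birkhoff_james_compression
      [OF ne \<rho> T A J unitaryD(1,2) [OF U] unitaryD(1,2) [OF V] TU AV bj that] .
  have dual: "approx_birkhoff_james \<epsilon> U V" if "?\<eta>' * ?s \<le> \<epsilon>" for \<epsilon>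
  proof (rule approx_birkhoff_james_cadjointD [OF unitaryD(1) [OF U] unitaryD(1) [OF V]])
    have "?\<eta>' * sqrt (1 - (onorm (cadjoint T))\<^sup>2 / \<rho>\<^sup>2) \<le> \<epsilon>"
      using that by (simp add: onorm_cadjoint [OF T])
    then show "approx_birkhoff_james \<epsilon> (cadjoint U) (cadjoint V)"
      by (rule approx_birkhoff_james_compression
          [OF ne \<rho> T' A' J unitaryD(3,4) [OF U] unitaryD(3,4) [OF V]
            cadjoint_compression [OF bJ T unitaryD(1) [OF U] TU]
            cadjoint_compression [OF bJ A unitaryD(1) [OF V] AV]
            birkhoff_james_cadjoint [OF T A bj]])
  qed
  have approx: "approx_birkhoff_james \<epsilon> U V" if "kappa \<rho> T A \<le> \<epsilon>" for \<epsilon>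
  proof (cases "?\<eta> \<le> ?\<eta>'")
    case True
    with that show ?thesis by (intro direct) (simp add: kappa_def min_def)
  next
    case False
    with that show ?thesis by (intro dual) (simp add: kappa_def min_def)
  qed
  have exact: "birkhoff_james U V" if "kappa \<rho> T A \<le> 0"
    using approx_birkhoff_james_zero_imp [OF unitaryD(1) [OF U] unitaryD(1) [OF V] approx [OF that]] .
  have "onorm T \<le> \<rho>"
    using compression_norm_le [OF J \<rho> unitaryD(2) [OF U] TU] \<rho> by (intro onorm_bound) auto
  then have "(onorm T)\<^sup>2 \<le> \<rho>\<^sup>2"
    using onorm_pos_le [OF bounded_clinearD(1) [OF T]] by (intro power_mono)
  then have s0: "0 \<le> ?s" using \<rho> by simp
  have kappa_nonpos: "kappa \<rho> T A \<le> 0" if "?\<eta> \<le> 0 \<or> ?\<eta>' \<le> 0"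
    unfolding kappa_def using that s0 by (intro mult_nonpos_nonneg) auto
  obtain x where x: "norming_sequence T x"
    using birkhoff_james_norming_sequence [OF ne T A bj] by blast
  obtain x' where x': "norming_sequence (cadjoint T) x'"
    using birkhoff_james_norming_sequence [OF ne T' A' birkhoff_james_cadjoint [OF T A bj]] by blast
  show "(\<forall>\<epsilon>. kappa \<rho> T A \<le> \<epsilon> \<and> \<epsilon> < 1 \<longrightarrow> approx_birkhoff_james \<epsilon> U V) \<and>
      (onorm T = \<rho> \<longrightarrow> birkhoff_james U V) \<and>
      (onorm A = \<rho> \<and>
        ((\<forall>x. norming_sequence T x \<longrightarrow> norming_sequence A x) \<or>
         (\<forall>x. norming_sequence (cadjoint T) x \<longrightarrow> norming_sequence (cadjoint A) x))
        \<longrightarrow> birkhoff_james U V)"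
  proof (intro conjI allI impI)
    show "approx_birkhoff_james \<epsilon> U V" if "kappa \<rho> T A \<le> \<epsilon> \<and> \<epsilon> < 1" for \<epsilon>
      using that approx by blast
    show "birkhoff_james U V" if "onorm T = \<rho>"
      using that \<rho> by (intro exact) (simp add: kappa_def)
    assume h: "onorm A = \<rho> \<and>
        ((\<forall>x. norming_sequence T x \<longrightarrow> norming_sequence A x) \<or>
         (\<forall>x. norming_sequence (cadjoint T) x \<longrightarrow> norming_sequence (cadjoint A) x))"
    then have "onorm A = \<rho>" "onorm (cadjoint A) = \<rho>" by (simp_all add: onorm_cadjoint [OF A])
    then have "?\<eta> \<le> 0 \<or> ?\<eta>' \<le> 0"
      using h eta_nonpos [OF \<rho> _ x] eta_nonpos [OF \<rho> _ x'] by blast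
    then show "birkhoff_james U V" by (intro exact kappa_nonpos)
  qed
qed

end
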